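(* Let $X$ be a Tychonoff space. Then $X$ is nearly pseudocompact if and only if every family of non-empty hard sets in $X$ with the finite intersection property has non-empty intersection.
   Context: All spaces are Tychonoff (completely regular Hausdorff). $\beta X$ denotes the Stone–Čech compactification of $X$ and $\upsilon X$ the Hewitt realcompactification of $X$, regarded as a subspace with $X \subseteq \upsilon X \subseteq \beta X$. The space $X$ is called nearly pseudocompact if $\upsilon X \setminus X$ is dense in $\beta X \setminus X$. A subspace $H$ of $X$ is called hard in $X$ (a hard set) if $H$ is closed in $X \cup K$ (with the subspace topology from $\beta X$), where $K = \mathrm{cl}_{\beta X}(\upsilon X \setminus X)$. A family of sets has the finite intersection property if every finite subfamily has non-empty intersection. *)

theory Defs
  imports "HOL-Analysis.Analysis"
begin

text \<open>The Stone--Cech compactification is realised as the closure of the image of \<open>X\<close> under the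
  evaluation map into the Tychonoff cube indexed by all continuous functions from \<open>X\<close> to the unit
  interval. Functions are made extensional so that the index set is exactly that function space.\<close>

definition unit_functions :: "'a topology \<Rightarrow> ('a \<Rightarrow> real) set" where
  "unit_functions X =
     {f \<in> extensional (topspace X). continuous_map X (top_of_set {0..1}) f}"

definition tychonoff_cube :: "'a topology \<Rightarrow> (('a \<Rightarrow> real) \<Rightarrow> real) topology" where
  "tychonoff_cube X = product_topology (\<lambda>_. top_of_set {0..1}) (unit_functions X)"

definition beta_embed :: "'a topology \<Rightarrow> 'a \<Rightarrow> ('a \<Rightarrow> real) \<Rightarrow> real" where
  "beta_embed X x = (\<lambda>f\<in>unit_functions X. f x)"

definition stone_cech :: "'a topology \<Rightarrow> (('a \<Rightarrow> real) \<Rightarrow> real) topology" where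
  "stone_cech X = subtopology (tychonoff_cube X)
     (tychonoff_cube X closure_of (beta_embed X ` topspace X))"

text \<open>The copy of \<open>X\<close> inside its Stone--Cech compactification; all inclusions
  \<open>X \<subseteq> \<upsilon>X \<subseteq> \<beta>X\<close> refer to it.\<close>

definition beta_copy :: "'a topology \<Rightarrow> (('a \<Rightarrow> real) \<Rightarrow> real) set" where
  "beta_copy X = beta_embed X ` topspace X"

text \<open>The Hewitt realcompactification consists of the points of \<open>\<beta>X\<close> to which every continuous
  real-valued function on \<open>X\<close>, bounded or not, extends continuously with a real value. Below it is
  shown to be realcompact and to contain \<open>X\<close> as a dense C-embedded subspace, which determines it
  uniquely.\<close>

definition hewitt :: "'a topology \<Rightarrow> (('a \<Rightarrow> real) \<Rightarrow> real) set" where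
  "hewitt X = {p \<in> topspace (stone_cech X).
     \<forall>f. continuous_map X euclideanreal f \<longrightarrow>
       (\<exists>g. continuous_map (subtopology (stone_cech X) (insert p (beta_copy X))) euclideanreal g \<and>
            (\<forall>x\<in>topspace X. g (beta_embed X x) = f x))}"

definition nearly_pseudocompact :: "'a topology \<Rightarrow> bool" where
  "nearly_pseudocompact X \<longleftrightarrow>
     subtopology (stone_cech X) (topspace (stone_cech X) - beta_copy X)
       closure_of (hewitt X - beta_copy X)
     = topspace (stone_cech X) - beta_copy X"

definition hard_in :: "'a set \<Rightarrow> 'a topology \<Rightarrow> bool" where
  "hard_in H X \<longleftrightarrow> H \<subseteq> topspace X \<and>
     closedin
       (subtopology (stone_cech X)
         (beta_copy X \<union> stone_cech X closure_of (hewitt X - beta_copy X)))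
       (beta_embed X ` H)"

lemma unit_functions_eq_mspace:
  "mspace (submetric (cfunspace X euclidean_metric) {f. f \<in> topspace X \<rightarrow> {0..1::real}})
   = unit_functions X"
proof -
  have "bounded (f ` topspace X)" if "f \<in> topspace X \<rightarrow> {0..1}" for f :: "'a \<Rightarrow> real"
    using that by (intro bounded_subset[OF bounded_closed_interval[of 0 1]]) auto
  then show ?thesis
    by (auto simp: unit_functions_def continuous_map_in_subtopology image_subset_iff_funcset)
qed

lemma topspace_tychonoff_cube:
  "topspace (tychonoff_cube X) = unit_functions X \<rightarrow>\<^sub>E {0..1}"
  by (simp add: tychonoff_cube_def)

lemma beta_copy_subset_cube: "beta_copy X \<subseteq> topspace (tychonoff_cube X)"
  by (auto simp: beta_copy_def beta_embed_def topspace_tychonoff_cube unit_functions_def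
      continuous_map_in_subtopology image_subset_iff)

lemma beta_copy_subset: "beta_copy X \<subseteq> topspace (stone_cech X)"
  using beta_copy_subset_cube[of X] closure_of_subset[of "beta_copy X" "tychonoff_cube X"]
  by (auto simp: stone_cech_def beta_copy_def)

lemma beta_copy_dense: "stone_cech X closure_of beta_copy X = topspace (stone_cech X)"
proof -
  have "beta_copy X \<subseteq> tychonoff_cube X closure_of beta_copy X"
    by (rule closure_of_subset[OF beta_copy_subset_cube])
  then show ?thesis
    using closure_of_subset_topspace[of "tychonoff_cube X" "beta_copy X"]
    by (simp add: stone_cech_def closure_of_subtopology Int_absorb1 Int_absorb2
        flip: beta_copy_def)
qed

lemma compact_space_stone_cech: "compact_space (stone_cech X)"
proof -
  have "compact_space (tychonoff_cube X)"
    by (simp add: tychonoff_cube_def compact_space_product_topology compact_space_subtopology)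
  then show ?thesis
    unfolding stone_cech_def
    by (intro compact_space_subtopology closedin_compact_space) auto
qed

lemma Hausdorff_space_stone_cech: "Hausdorff_space (stone_cech X)"
  by (simp add: stone_cech_def tychonoff_cube_def Hausdorff_space_subtopology
      Hausdorff_space_product_topology)

lemma embedding_map_beta_embed:
  assumes "completely_regular_space X" "Hausdorff_space X"
  shows "embedding_map X (stone_cech X) (beta_embed X)"
proof -
  have "embedding_map X (tychonoff_cube X) (beta_embed X)"
    using completely_regular_space_cube_embedding_explicit[OF assms]
    unfolding unit_functions_eq_mspace tychonoff_cube_def beta_embed_def[abs_def] .
  moreover have "beta_embed X ` topspace X \<subseteq> tychonoff_cube X closure_of (beta_embed X ` topspace X)"
    using closure_of_subset[OF beta_copy_subset_cube] by (simp add: beta_copy_def)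
  ultimately show ?thesis
    by (simp add: stone_cech_def embedding_map_in_subtopology)
qed

lemma continuous_map_stone_cech_component:
  "f \<in> unit_functions X \<Longrightarrow> continuous_map (stone_cech X) euclideanreal (\<lambda>p. p f)"
  unfolding stone_cech_def tychonoff_cube_def
  by (rule continuous_map_from_subtopology, rule continuous_map_into_fulltopology,
      rule continuous_map_product_projection)

text \<open>The extension property that characterises the Stone--Cech compactification.\<close>

lemma stone_cech_extension:
  assumes f: "continuous_map X euclideanreal f" and bdd: "bounded (f ` topspace X)"
  obtains g where "continuous_map (stone_cech X) euclideanreal g"
    "\<And>x. x \<in> topspace X \<Longrightarrow> g (beta_embed X x) = f x"
proof -
  obtain B where B: "B > 0" "\<And>x. x \<in> topspace X \<Longrightarrow> \<bar>f x\<bar> \<le> B"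
    using bdd by (auto simp: bounded_pos)
  define h where "h = restrict (\<lambda>x. (f x + B) / (2 * B)) (topspace X)"
  have "continuous_map X euclideanreal (\<lambda>x. (f x + B) / (2 * B))"
    using B(1) f by (intro continuous_intros) auto
  then have "continuous_map X euclideanreal h"
    by (rule continuous_map_eq) (simp add: h_def)
  moreover have "h x \<in> {0..1}" if "x \<in> topspace X" for x
    using B(1) B(2)[OF that] that by (auto simp: h_def field_simps abs_le_iff)
  ultimately have h: "h \<in> unit_functions X"
    by (auto simp: unit_functions_def continuous_map_in_subtopology h_def)
  show thesis
  proof
    show "continuous_map (stone_cech X) euclideanreal (\<lambda>p. 2 * B * p h - B)"
      by (intro continuous_intros continuous_map_stone_cech_component h)
    show "2 * B * beta_embed X x h - B = f x" if "x \<in> topspace X" for x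
      using h that B(1) by (simp add: beta_embed_def) (simp add: h_def)
  qed
qed

lemma hewitt_subset: "hewitt X \<subseteq> topspace (stone_cech X)"
  by (auto simp: hewitt_def)

lemma beta_copy_subset_hewitt:
  assumes "completely_regular_space X" "Hausdorff_space X"
  shows "beta_copy X \<subseteq> hewitt X"
proof
  fix p assume p: "p \<in> beta_copy X"
  have "homeomorphic_map X (subtopology (stone_cech X) (beta_copy X)) (beta_embed X)"
    using embedding_map_beta_embed[OF assms] by (simp add: embedding_map_def beta_copy_def)
  then obtain r where r: "homeomorphic_maps X (subtopology (stone_cech X) (beta_copy X)) (beta_embed X) r"
    by (auto simp: homeomorphic_map_maps)
  show "p \<in> hewitt X"
    unfolding hewitt_def
  proof (intro CollectI conjI allI impI)
    show "p \<in> topspace (stone_cech X)" using p beta_copy_subset by blast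
    fix f assume "continuous_map X euclideanreal f"
    then show "\<exists>g. continuous_map (subtopology (stone_cech X) (insert p (beta_copy X))) euclideanreal g \<and>
      (\<forall>x\<in>topspace X. g (beta_embed X x) = f x)"
      using r p by (intro exI[of _ "f \<circ> r"])
        (auto simp: homeomorphic_maps_def insert_absorb intro: continuous_map_compose)
  qed
qed

lemma hewitt_extension:
  assumes X: "completely_regular_space X" "Hausdorff_space X"
    and f: "continuous_map X euclideanreal f"
  obtains g where "continuous_map (subtopology (stone_cech X) (hewitt X)) euclideanreal g"
    "\<And>x. x \<in> topspace X \<Longrightarrow> g (beta_embed X x) = f x"
proof -
  have "inj_on (beta_embed X) (topspace X)"
    using embedding_map_beta_embed[OF X] by (simp add: embedding_map_def homeomorphic_eq_everything_map)
  then obtain r where r: "\<And>x. x \<in> topspace X \<Longrightarrow> r (beta_embed X x) = x"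
    by (metis inv_into_f_f)
  obtain g where "continuous_map (subtopology (stone_cech X) (hewitt X)) euclideanreal g"
    "\<And>p. p \<in> beta_copy X \<Longrightarrow> g p = f (r p)"
  proof (rule continuous_map_extension_pointwise
        [of euclideanreal "beta_copy X" "hewitt X" "stone_cech X" "\<lambda>p. f (r p)"])
    show "regular_space euclideanreal"
      using Metric_space.regular_space_mtopology[OF Met_TC.Metric_space_axioms] by simp
    show "beta_copy X \<subseteq> hewitt X" by (rule beta_copy_subset_hewitt[OF X])
    show "hewitt X \<subseteq> stone_cech X closure_of beta_copy X"
      by (simp add: beta_copy_dense hewitt_subset)
    fix p assume "p \<in> hewitt X"
    then obtain g where "continuous_map (subtopology (stone_cech X) (insert p (beta_copy X))) euclideanreal g"
      "\<forall>x\<in>topspace X. g (beta_embed X x) = f x"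
      using f by (auto simp: hewitt_def)
    then show "\<exists>g. continuous_map (subtopology (stone_cech X) (insert p (beta_copy X))) euclideanreal g \<and>
        (\<forall>x\<in>beta_copy X. g x = f (r x))"
      using r by (auto simp: beta_copy_def)
  qed blast
  then show thesis
    using that r by (auto simp: beta_copy_def)
qed

text \<open>A space is realcompact if it is homeomorphic to a closed subspace of a power of the
  reals.\<close>

lemma realcompact_hewitt:
  fixes X :: "'a topology"
  assumes X: "completely_regular_space X" "Hausdorff_space X"
  shows "\<exists>(I :: ('a \<Rightarrow> real) set) e.
    embedding_map (subtopology (stone_cech X) (hewitt X)) (product_topology (\<lambda>_. euclideanreal) I) e \<and>
    closedin (product_topology (\<lambda>_. euclideanreal) I) (e ` hewitt X)"
proof -
  define U where "U = subtopology (stone_cech X) (hewitt X)"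
  define I where "I = {f \<in> extensional (topspace X). continuous_map X euclideanreal f}"
  define P where "P = product_topology (\<lambda>_::'a \<Rightarrow> real. euclideanreal) I"
  have topU: "topspace U = hewitt X"
    using hewitt_subset by (auto simp: U_def)
  have topP: "topspace P = extensional I"
    by (auto simp: P_def PiE_def)
  have unit_I: "unit_functions X \<subseteq> I"
    by (auto simp: unit_functions_def I_def continuous_map_in_subtopology)
  have "\<exists>g. continuous_map U euclideanreal g \<and> (\<forall>x\<in>topspace X. g (beta_embed X x) = f x)"
    if "f \<in> I" for f
    using that hewitt_extension[OF X, of f] unfolding I_def U_def by (metis (no_types, lifting) mem_Collect_eq)
  then obtain G where G: "\<And>f. f \<in> I \<Longrightarrow> continuous_map U euclideanreal (G f)"
    "\<And>f x. f \<in> I \<Longrightarrow> x \<in> topspace X \<Longrightarrow> G f (beta_embed X x) = f x"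
    by metis
  define e where "e p = (\<lambda>f\<in>I. G f p)" for p
  have conte: "continuous_map U P e"
    by (auto simp: P_def e_def continuous_map_componentwise G(1))
  have densU: "p \<in> U closure_of beta_copy X" if "p \<in> hewitt X" for p
    using that beta_copy_subset_hewitt[OF X] hewitt_subset[of X] beta_copy_dense[of X]
    by (auto simp: U_def closure_of_subtopology Int_absorb1)
  have Gunit: "G f p = p f" if "f \<in> unit_functions X" "p \<in> hewitt X" for f p
  proof (rule forall_in_closure_of_eq[OF densU[OF that(2)], of euclideanreal "G f" "\<lambda>p. p f"])
    show "continuous_map U euclideanreal (G f)" using G(1) that unit_I by blast
    show "continuous_map U euclideanreal (\<lambda>p. p f)"
      unfolding U_def by (intro continuous_map_from_subtopology continuous_map_stone_cech_component that)
    show "G f q = q f" if "q \<in> beta_copy X" for q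
      using that G(2) \<open>f \<in> unit_functions X\<close> unit_I by (auto simp: beta_copy_def beta_embed_def)
  qed auto
  define r where "r y = restrict y (unit_functions X)" for y :: "('a \<Rightarrow> real) \<Rightarrow> real"
  have re: "r (e p) = p" if "p \<in> hewitt X" for p
  proof -
    have "p \<in> topspace (tychonoff_cube X)"
      using that hewitt_subset by (auto simp: stone_cech_def)
    then have "p \<in> extensional (unit_functions X)"
      by (auto simp: topspace_tychonoff_cube PiE_def)
    then show ?thesis
      using that unit_I Gunit by (auto simp: r_def e_def extensional_def fun_eq_iff)
  qed
  have contr: "continuous_map P (product_topology (\<lambda>_. euclideanreal) (unit_functions X)) r"
    using unit_I
    by (auto simp: P_def r_def continuous_map_componentwise intro!: continuous_map_product_projection)
  have cube_sub: "tychonoff_cube X =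
      subtopology (product_topology (\<lambda>_. euclideanreal) (unit_functions X)) (topspace (tychonoff_cube X))"
    by (simp add: topspace_tychonoff_cube) (simp add: tychonoff_cube_def subtopology_product_topology)
  have emb: "embedding_map U P e"
    unfolding embedding_map_def homeomorphic_map_maps
  proof (intro exI)
    have "hewitt X \<subseteq> topspace (tychonoff_cube X) \<inter> tychonoff_cube X closure_of beta_copy X"
      using hewitt_subset[of X] by (simp add: stone_cech_def beta_copy_def)
    then have "U = subtopology (product_topology (\<lambda>_. euclideanreal) (unit_functions X)) (hewitt X)"
      unfolding U_def stone_cech_def beta_copy_def
      by (subst (1) cube_sub) (simp add: subtopology_subtopology Int_absorb1 Int_assoc[symmetric])
    moreover have "r ` e ` hewitt X \<subseteq> hewitt X"
      using re by auto
    ultimately have "continuous_map (subtopology P (e ` topspace U)) U r"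
      using contr by (auto simp: topU continuous_map_in_subtopology intro: continuous_map_from_subtopology)
    then show "homeomorphic_maps U (subtopology P (e ` topspace U)) e r"
      using conte re by (auto simp: homeomorphic_maps_def topU continuous_map_in_subtopology)
  qed
  have "P closure_of (e ` hewitt X) \<subseteq> e ` hewitt X"
  proof
    fix y assume y: "y \<in> P closure_of (e ` hewitt X)"
    have "e ` hewitt X \<subseteq> e ` (U closure_of beta_copy X)"
      using densU by blast
    also have "\<dots> \<subseteq> P closure_of (e ` beta_copy X)"
      by (rule continuous_map_image_closure_subset[OF conte])
    finally have y: "y \<in> P closure_of (e ` beta_copy X)"
      using y closure_of_mono closure_of_closure_of by (metis subsetD)
    have yI: "y \<in> extensional I"
      using subsetD[OF closure_of_subset_topspace y] by (simp add: topP)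
    let ?R = "product_topology (\<lambda>_::'a \<Rightarrow> real. euclideanreal) (unit_functions X)"
    define p where "p = r y"
    have rcopy: "r ` e ` beta_copy X = beta_copy X"
      using re subsetD[OF beta_copy_subset_hewitt[OF X]] by (simp add: image_image)
    have p1: "p \<in> ?R closure_of beta_copy X"
      using continuous_map_image_closure_subset[OF contr, of "e ` beta_copy X"] y
      unfolding rcopy p_def by blast
    have "closedin ?R (topspace (tychonoff_cube X))"
      by (simp add: topspace_tychonoff_cube closedin_product_topology)
    then have p2: "p \<in> topspace (tychonoff_cube X)"
      by (rule subsetD[OF closure_of_minimal[OF beta_copy_subset_cube] p1])
    have "p \<in> tychonoff_cube X closure_of beta_copy X"
      using p1 p2 beta_copy_subset_cube[of X]
      by (subst cube_sub) (simp add: closure_of_subtopology Int_absorb1)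
    then have pbeta: "p \<in> topspace (stone_cech X)"
      using p2 by (simp add: stone_cech_def beta_copy_def)
    define h where "h f = restrict (\<lambda>x. min 1 \<bar>f x - y f\<bar>) (topspace X)" for f
    have hunit: "h f \<in> unit_functions X" if "f \<in> I" for f
    proof -
      have "continuous_map X euclideanreal (\<lambda>x. min 1 \<bar>f x - y f\<bar>)"
        using that by (intro continuous_intros) (auto simp: I_def)
      then have "continuous_map X euclideanreal (h f)"
        by (rule continuous_map_eq) (simp add: h_def)
      then show ?thesis
        by (auto simp: unit_functions_def continuous_map_in_subtopology h_def)
    qed
    have ph: "p (h f) = 0" if f: "f \<in> I" for f
    proof -
      have proj: "continuous_map P euclideanreal (\<lambda>z. z k)" if "k \<in> I" for k
        unfolding P_def using that by (rule continuous_map_product_projection)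
      have "y (h f) = min 1 \<bar>y f - y f\<bar>"
      proof (rule forall_in_closure_of_eq[OF y, of euclideanreal
            "\<lambda>z. z (h f)" "\<lambda>z. min 1 \<bar>z f - y f\<bar>"])
        show "continuous_map P euclideanreal (\<lambda>z. z (h f))"
          using proj hunit[OF f] unit_I by blast
        show "continuous_map P euclideanreal (\<lambda>z. min 1 \<bar>z f - y f\<bar>)"
          using proj[OF f] by (intro continuous_intros) auto
        show "z (h f) = min 1 \<bar>z f - y f\<bar>" if z: "z \<in> e ` beta_copy X" for z
        proof -
          obtain x where x: "x \<in> topspace X" "z = e (beta_embed X x)"
            using z by (auto simp: beta_copy_def)
          have "h f \<in> I" using hunit[OF f] unit_I by blast
          with x f show ?thesis
            by (simp add: e_def G(2)) (simp add: h_def)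
        qed
      qed auto
      then show ?thesis
        using hunit[OF f] by (simp add: p_def r_def)
    qed
    have pH: "p \<in> hewitt X"
      unfolding hewitt_def
    proof (intro CollectI conjI allI impI)
      show "p \<in> topspace (stone_cech X)" by (rule pbeta)
      fix f0 assume f0: "continuous_map X euclideanreal f0"
      define f where "f = restrict f0 (topspace X)"
      have fI: "f \<in> I"
        using continuous_map_eq[OF f0, of f] by (auto simp: I_def f_def)
      obtain g where g: "continuous_map (subtopology (stone_cech X) (insert p (beta_copy X))) euclideanreal g"
        "\<And>q. q \<in> beta_copy X \<Longrightarrow> g q = G f q"
      proof (rule continuous_map_extension_pointwise_alt
            [of euclideanreal "beta_copy X" "insert p (beta_copy X)" "stone_cech X" "G f"])
        show "regular_space euclideanreal"
          using Metric_space.regular_space_mtopology[OF Met_TC.Metric_space_axioms] by simp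
        show "insert p (beta_copy X) \<subseteq> stone_cech X closure_of beta_copy X"
          using beta_copy_dense pbeta beta_copy_subset by blast
        have "continuous_map (subtopology U (beta_copy X)) euclideanreal (G f)"
          by (intro continuous_map_from_subtopology G(1) fI)
        then show "continuous_map (subtopology (stone_cech X) (beta_copy X)) euclideanreal (G f)"
          using beta_copy_subset_hewitt[OF X] by (simp add: U_def subtopology_subtopology Int_absorb1)
        have "limitin euclideanreal (G f) (y f) (atin_within (stone_cech X) p (beta_copy X))"
          unfolding limitin_canonical_iff tendsto_iff
        proof (intro allI impI)
          fix \<epsilon> :: real assume "\<epsilon> > 0"
          let ?N = "{q \<in> topspace (stone_cech X). q (h f) \<in> {..<min \<epsilon> 1}}"
          have "openin (stone_cech X) ?N"
            by (rule openin_continuous_map_preimage[OF continuous_map_stone_cech_component[OF hunit[OF fI]]]) simp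
          moreover have "p \<in> ?N"
            using ph[OF fI] pbeta \<open>\<epsilon> > 0\<close> by simp
          moreover have "dist (G f q) (y f) < \<epsilon>" if q: "q \<in> ?N" "q \<in> beta_copy X" for q
          proof -
            obtain x where x: "x \<in> topspace X" "q = beta_embed X x"
              using q by (auto simp: beta_copy_def)
            have "min 1 \<bar>f x - y f\<bar> < min \<epsilon> 1"
              using q(1) x hunit[OF fI] by (simp add: beta_embed_def) (simp add: h_def)
            then have "\<bar>f x - y f\<bar> < \<epsilon>" by linarith
            then show ?thesis
              using x fI by (simp add: G(2) dist_real_def)
          qed
          ultimately show "\<forall>\<^sub>F q in atin_within (stone_cech X) p (beta_copy X). dist (G f q) (y f) < \<epsilon>"
            unfolding eventually_atin_within by blast
        qed
        then show "\<exists>l. limitin euclideanreal (G f) l (atin_within (stone_cech X) t (beta_copy X))"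
          if "t \<in> insert p (beta_copy X) - beta_copy X" for t
          using that by blast
      qed auto
      have "g (beta_embed X x) = f0 x" if "x \<in> topspace X" for x
        using that g(2)[of "beta_embed X x"] G(2)[OF fI that] by (simp add: beta_copy_def f_def)
      with g(1) show "\<exists>g. continuous_map (subtopology (stone_cech X) (insert p (beta_copy X))) euclideanreal g \<and>
          (\<forall>x\<in>topspace X. g (beta_embed X x) = f0 x)"
        by blast
    qed
    have "G f p = y f" if f: "f \<in> I" for f
    proof -
      have "p (h f) = min 1 \<bar>G f p - y f\<bar>"
      proof (rule forall_in_closure_of_eq[OF densU[OF pH], of euclideanreal
            "\<lambda>q. q (h f)" "\<lambda>q. min 1 \<bar>G f q - y f\<bar>"])
        show "continuous_map U euclideanreal (\<lambda>q. q (h f))"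
          unfolding U_def
          by (intro continuous_map_from_subtopology continuous_map_stone_cech_component hunit f)
        show "continuous_map U euclideanreal (\<lambda>q. min 1 \<bar>G f q - y f\<bar>)"
          using G(1)[OF f] by (intro continuous_intros) auto
        show "q (h f) = min 1 \<bar>G f q - y f\<bar>" if q: "q \<in> beta_copy X" for q
        proof -
          obtain x where x: "x \<in> topspace X" "q = beta_embed X x"
            using q by (auto simp: beta_copy_def)
          with f hunit[OF f] show ?thesis
            by (simp add: G(2)) (simp add: beta_embed_def h_def)
        qed
      qed auto
      then show ?thesis using ph[OF f] by (auto simp: min_def split: if_splits)
    qed
    then have "e p = y"
      using yI by (auto simp: e_def extensional_def fun_eq_iff)
    then show "y \<in> e ` hewitt X" using pH by blast
  qed
  then have "closedin P (e ` hewitt X)"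
    using conte topU by (metis closure_of_subset_eq continuous_map_image_subset_topspace)
  then show ?thesis
    using emb unfolding U_def P_def by blast
qed

end

theory Submission
  imports Defs
begin

text \<open>Let \<open>K\<close> be the closure of \<open>\<upsilon>X - X\<close> in \<open>\<beta>X\<close>. The space is nearly pseudocompact exactly when
  \<open>X \<union> K\<close> is all of \<open>\<beta>X\<close>. In that case the hard sets are closed in \<open>\<beta>X\<close>, and the intersection
  property is the compactness of \<open>\<beta>X\<close>.

  Otherwise some point \<open>p\<close> of \<open>\<beta>X\<close> lies outside \<open>X \<union> K\<close>. A closed neighbourhood of \<open>p\<close> that misses
  \<open>K\<close> meets \<open>X \<union> K\<close> only in points of \<open>X\<close>, so its trace on \<open>X\<close> is hard. These traces have the
  finite intersection property because \<open>X\<close> is dense in \<open>\<beta>X\<close>, but a point common to all of them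
  could only be \<open>p\<close> itself, by regularity, and \<open>p\<close> is not in \<open>X\<close>.\<close>

text \<open>The definition speaks of a closure within the subspace \<open>\<beta>X - X\<close>. In this form the condition
  concerns the very space \<open>X \<union> K\<close> in which hard sets are closed.\<close>

lemma nearly_pseudocompact_iff:
  "nearly_pseudocompact X \<longleftrightarrow>
    topspace (stone_cech X) \<subseteq> beta_copy X \<union> stone_cech X closure_of (hewitt X - beta_copy X)"
proof -
  let ?R = "topspace (stone_cech X) - beta_copy X"
  have "?R \<inter> (hewitt X - beta_copy X) = hewitt X - beta_copy X"
    using hewitt_subset by blast
  then have "nearly_pseudocompact X \<longleftrightarrow>
      ?R \<inter> stone_cech X closure_of (hewitt X - beta_copy X) = ?R"
    by (simp add: nearly_pseudocompact_def closure_of_subtopology)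
  then show ?thesis by blast
qed

lemma nearly_pseudocompact_hard_in_closedin:
  assumes "nearly_pseudocompact X" and "hard_in H X"
  shows "closedin (stone_cech X) (beta_embed X ` H)"
proof -
  let ?K = "stone_cech X closure_of (hewitt X - beta_copy X)"
  have "beta_copy X \<union> ?K = topspace (stone_cech X)"
    using assms(1) closure_of_subset_topspace[of "stone_cech X"] beta_copy_subset[of X]
    unfolding nearly_pseudocompact_iff by blast
  then show ?thesis
    using assms(2) by (simp add: hard_in_def)
qed

text \<open>This supplies the hard sets of a space that is not nearly pseudocompact: missing \<open>K\<close> leaves
  \<open>C\<close> no points of \<open>X \<union> K\<close> outside \<open>X\<close>.\<close>

lemma hard_in_trace:
  assumes "closedin (stone_cech X) C"
    and "disjnt C (stone_cech X closure_of (hewitt X - beta_copy X))"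
  shows "hard_in {x \<in> topspace X. beta_embed X x \<in> C} X"
proof -
  let ?K = "stone_cech X closure_of (hewitt X - beta_copy X)"
  have "beta_embed X ` {x \<in> topspace X. beta_embed X x \<in> C} = C \<inter> (beta_copy X \<union> ?K)"
    using assms(2) by (auto simp: beta_copy_def disjnt_iff)
  then show ?thesis
    using assms(1) by (auto simp: hard_in_def closedin_subtopology)
qed

lemma regular_space_stone_cech: "regular_space (stone_cech X)"
  by (simp add: compact_Hausdorff_imp_regular_space compact_space_stone_cech
      Hausdorff_space_stone_cech)

lemma beta_copy_meets_openin:
  assumes "openin (stone_cech X) U" and "p \<in> U"
  obtains x where "x \<in> topspace X" and "beta_embed X x \<in> U"
proof -
  have "p \<in> stone_cech X closure_of beta_copy X"
    using openin_subset[OF assms(1)] assms(2) by (auto simp: beta_copy_dense)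
  with assms that show thesis
    by (auto simp: in_closure_of beta_copy_def)
qed

theorem theorem8:
  fixes X :: "'a topology"
  assumes "completely_regular_space X" and "Hausdorff_space X"
  shows "nearly_pseudocompact X \<longleftrightarrow>
    (\<forall>\<H>. (\<forall>H\<in>\<H>. hard_in H X \<and> H \<noteq> {}) \<and>
          (\<forall>\<F>. finite \<F> \<and> \<F> \<subseteq> \<H> \<longrightarrow> \<Inter>\<F> \<noteq> {})
        \<longrightarrow> \<Inter>\<H> \<noteq> {})"
proof (intro iffI allI impI)
  fix \<H> :: "'a set set"
  assume npc: "nearly_pseudocompact X"
    and \<H>: "(\<forall>H\<in>\<H>. hard_in H X \<and> H \<noteq> {}) \<and> (\<forall>\<F>. finite \<F> \<and> \<F> \<subseteq> \<H> \<longrightarrow> \<Inter>\<F> \<noteq> {})"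
  have sub: "H \<subseteq> topspace X" if "H \<in> \<H>" for H
    using \<H> that by (auto simp: hard_in_def)
  have inj: "inj_on (beta_embed X) (topspace X)"
    using embedding_map_beta_embed[OF assms]
    by (simp add: embedding_map_def homeomorphic_eq_everything_map)
  have fip: "\<Inter>\<G> \<noteq> {}" if fin: "finite \<G>" and \<G>: "\<G> \<subseteq> (`) (beta_embed X) ` \<H>" for \<G>
  proof -
    obtain \<F> where \<F>: "\<F> \<subseteq> \<H>" "finite \<F>" "\<G> = (`) (beta_embed X) ` \<F>"
      using finite_subset_image[OF fin \<G>] by blast
    then obtain x where "x \<in> \<Inter>\<F>"
      using \<H> by blast
    then have "beta_embed X x \<in> \<Inter>\<G>"
      using \<F>(3) by blast
    then show ?thesis by blast
  qed
  have "\<forall>C \<in> (`) (beta_embed X) ` \<H>. closedin (stone_cech X) C"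
    using nearly_pseudocompact_hard_in_closedin[OF npc] \<H> by blast
  then have "\<Inter>((`) (beta_embed X) ` \<H>) \<noteq> {}"
    using fip compact_space_stone_cech[of X, unfolded compact_space_fip,
        THEN spec[of _ "(`) (beta_embed X) ` \<H>"]] by simp
  then obtain p where p: "\<And>H. H \<in> \<H> \<Longrightarrow> p \<in> beta_embed X ` H"
    by blast
  show "\<Inter>\<H> \<noteq> {}"
  proof (cases "\<H> = {}")
    case False
    then obtain H0 where "H0 \<in> \<H>" by blast
    with p obtain x where x: "x \<in> H0" "p = beta_embed X x" by blast
    have "x \<in> H" if "H \<in> \<H>" for H
    proof (rule inj_on_image_mem_iff[OF inj _ sub[OF that], THEN iffD1])
      show "x \<in> topspace X"
        using x(1) sub[OF \<open>H0 \<in> \<H>\<close>] by blast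
      show "beta_embed X x \<in> beta_embed X ` H"
        using p[OF that] x(2) by simp
    qed
    then show ?thesis by blast
  qed simp
next
  assume fip: "\<forall>\<H>. (\<forall>H\<in>\<H>. hard_in H X \<and> H \<noteq> {}) \<and>
      (\<forall>\<F>. finite \<F> \<and> \<F> \<subseteq> \<H> \<longrightarrow> \<Inter>\<F> \<noteq> {}) \<longrightarrow> \<Inter>\<H> \<noteq> {}"
  let ?S = "stone_cech X"
  let ?K = "?S closure_of (hewitt X - beta_copy X)"
  show "nearly_pseudocompact X"
    unfolding nearly_pseudocompact_iff
  proof (rule subsetI, rule ccontr)
    fix p assume pS: "p \<in> topspace ?S" and p: "p \<notin> beta_copy X \<union> ?K"
    \<comment> \<open>Each closed neighbourhood \<open>C\<close> is paired with an open \<open>U\<close> that witnesses it: density of \<open>X\<close>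
      will be applied to intersections of the open sets.\<close>
    define \<N> where "\<N> = {(U, C). openin ?S U \<and> closedin ?S C \<and> p \<in> U \<and> U \<subseteq> C \<and> disjnt C ?K}"
    define \<H> where "\<H> = (\<lambda>(U, C). {x \<in> topspace X. beta_embed X x \<in> C}) ` \<N>"
    have nbhd: "\<exists>U C. (U, C) \<in> \<N> \<and> disjnt C D" if "closedin ?S D" "p \<notin> D" for D
    proof -
      have "closedin ?S (D \<union> ?K)"
        using that(1) by (simp add: closedin_Un)
      moreover have "p \<in> topspace ?S - (D \<union> ?K)"
        using pS p that(2) by blast
      ultimately obtain U C where "openin ?S U" "closedin ?S C" "p \<in> U" "U \<subseteq> C"
          "C \<subseteq> topspace ?S - (D \<union> ?K)"
        using regular_space_stone_cech[of X, folded neighbourhood_base_of_closedin,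
            unfolded neighbourhood_base_of,
            rule_format, of "topspace ?S - (D \<union> ?K)" p]
        by (auto simp: openin_diff)
      then show ?thesis
        unfolding \<N>_def disjnt_iff by blast
    qed
    have inter: "\<Inter>\<F> \<noteq> {}" if "finite \<F>" "\<F> \<subseteq> \<H>" for \<F>
    proof -
      \<comment> \<open>A neighbourhood of \<open>p\<close> is carried through the induction, since non-emptiness alone is not
        preserved when one more set is intersected.\<close>
      have "\<exists>V. openin ?S V \<and> p \<in> V \<and> (\<forall>x\<in>topspace X. beta_embed X x \<in> V \<longrightarrow> x \<in> \<Inter>\<F>)"
        using that
      proof (induction \<F>)
        case empty
        then show ?case using pS by blast
      next
        case (insert H \<F>)
        then obtain V where V: "openin ?S V" "p \<in> V"
            "\<forall>x\<in>topspace X. beta_embed X x \<in> V \<longrightarrow> x \<in> \<Inter>\<F>"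
          by blast
        obtain U C where "(U, C) \<in> \<N>" "H = {x \<in> topspace X. beta_embed X x \<in> C}"
          using insert.prems unfolding \<H>_def by auto
        with V show ?case
          by (intro exI[of _ "U \<inter> V"]) (auto simp: \<N>_def)
      qed
      then obtain V where V: "openin ?S V" "p \<in> V"
          "\<And>x. x \<in> topspace X \<Longrightarrow> beta_embed X x \<in> V \<Longrightarrow> x \<in> \<Inter>\<F>"
        by blast
      obtain x where "x \<in> topspace X" "beta_embed X x \<in> V"
        using beta_copy_meets_openin[OF V(1,2)] .
      with V(3) have "x \<in> \<Inter>\<F>" by blast
      then show ?thesis by blast
    qed
    have hard: "hard_in H X \<and> H \<noteq> {}" if H: "H \<in> \<H>" for H
    proof
      obtain U C where "(U, C) \<in> \<N>" "H = {x \<in> topspace X. beta_embed X x \<in> C}"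
        using H unfolding \<H>_def by auto
      then show "hard_in H X"
        using hard_in_trace unfolding \<N>_def by blast
      show "H \<noteq> {}"
        using inter[of "{H}"] H by simp
    qed
    have "\<Inter>\<H> \<noteq> {}"
      using fip[THEN spec[of _ \<H>]] hard inter by simp
    then obtain x where "x \<in> \<Inter>\<H>" by blast
    then have x: "x \<in> topspace X \<and> beta_embed X x \<in> C" if "(U, C) \<in> \<N>" for U C
      using that unfolding \<H>_def by blast
    \<comment> \<open>By regularity the image of \<open>x\<close> is in no closed set without \<open>p\<close>; its own singleton is one.\<close>
    have avoid: "beta_embed X x \<notin> D" if "closedin ?S D" "p \<notin> D" for D
      using nbhd[OF that] x unfolding disjnt_iff by blast
    have "x \<in> topspace X"
      using nbhd[of "{}"] x by auto
    then have xc: "beta_embed X x \<in> beta_copy X"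
      by (simp add: beta_copy_def)
    then have "closedin ?S {beta_embed X x}"
      using beta_copy_subset by (intro closedin_Hausdorff_singleton Hausdorff_space_stone_cech) blast
    then show False
      using avoid[of "{beta_embed X x}"] xc p by blast
  qed
qed

end
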